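(* Let $(\Omega,\Sigma,\mu)$ be a finite measure space, $Y$ a Banach space and $T\in\mathcal{L}(L_1(\mu),Y)$ a strong Radon--Nikod\'ym operator. Then for all $\varepsilon>0$ there exists $S\in\operatorname{RSE}(L_1(\mu),Y)$ such that $\|T-S\|\le\varepsilon$. Moreover, there is $\beta>0$ such that $$\overline{S(B_{L_1(\mu)})}\subseteq\beta\,\overline{T(B_{L_1(\mu)})}.$$
   Context: Banach spaces are over $\mathbb{K}$, where $\mathbb{K}=\mathbb{R}$ or $\mathbb{C}$, and are nonzero (in particular $L_1(\mu)\neq\{0\}$). $\mathbb{T}=\{\theta\in\mathbb{K}\colon |\theta|=1\}$; $B_X$, $S_X$ are the closed unit ball and unit sphere of $X$; $\mathcal{L}(X,Y)$ is the space of bounded linear operators with the operator norm. $T\in\operatorname{RSE}(X,Y)$ (range strongly exposing) means: there exists $x_0\in S_X$ such that whenever $(x_n)\subseteq B_X$ satisfies $\|Tx_n\|\to\|T\|$, there are a subsequence $(x_{\sigma(n)})$ and $\theta\in\mathbb{T}$ with $Tx_{\sigma(n)}\to\theta Tx_0$ in norm. A closed convex subset $D$ of a Banach space is an RNP set if every nonempty subset of $D$ has slices (nonempty intersections of it with open half-spaces) of arbitrarily small diameter. $T\in\mathcal{L}(X,Y)$ is a strong Radon--Nikod\'ym operator if $\overline{T(B_X)}$ is an RNP set. *)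

theory Defs
  imports "HOL-Analysis.Analysis"
begin

section \<open>Scalars and Banach spaces over them\<close>

text \<open>
  The scalar field is either the real or the complex numbers: up to an isometric field embedding
  into the complex numbers, it is the subfield of real numbers or the whole field.
  (Such an embedding automatically maps 1 to 1 and is linear over the reals.)
\<close>

class real_or_complex = real_normed_field + euclidean_space +
  assumes real_or_complex:
    "\<exists>\<phi>::'a \<Rightarrow> complex.
       (\<forall>x y. \<phi> (x + y) = \<phi> x + \<phi> y) \<and> (\<forall>x y. \<phi> (x * y) = \<phi> x * \<phi> y) \<and>
       (\<forall>x. norm (\<phi> x) = norm x) \<and> (range \<phi> = \<real> \<or> range \<phi> = UNIV)"

instance real :: real_or_complex
proof
  have "range complex_of_real = \<real>"
    by (simp add: Reals_def)
  then show "\<exists>\<phi>::real \<Rightarrow> complex.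
       (\<forall>x y. \<phi> (x + y) = \<phi> x + \<phi> y) \<and> (\<forall>x y. \<phi> (x * y) = \<phi> x * \<phi> y) \<and>
       (\<forall>x. norm (\<phi> x) = norm x) \<and> (range \<phi> = \<real> \<or> range \<phi> = UNIV)"
    by (intro exI[of _ complex_of_real]) simp
qed

instance complex :: real_or_complex
  by standard (intro exI[of _ id], simp)

text \<open>
  A Banach space over \<open>'k\<close> is a type of class \<open>banach\<close> (a real Banach space) with a compatible
  multiplication by scalars from \<open>'k\<close>. For real scalars this multiplication is necessarily \<open>scaleR\<close>.
\<close>

locale banach_over = vector_space smul
  for smul :: "'k::real_or_complex \<Rightarrow> 'b::banach \<Rightarrow> 'b" +
  assumes smul_of_real: "smul (of_real r) y = r *\<^sub>R y"
    and norm_smul: "norm (smul c y) = norm c * norm y"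


section \<open>Bounded operators and the class RSE\<close>

text \<open>
  The underlying set of \<open>L\<^sub>1(\<mu>)\<close> depends on the measure, so domains of operators are normed spaces
  given by an explicit set of vectors. Operators are functions on the whole type of which only the
  values on \<open>vecs X\<close> matter.
\<close>

record ('k, 'x) nspace =
  vecs :: "'x set"
  plus_v :: "'x \<Rightarrow> 'x \<Rightarrow> 'x"
  scale_v :: "'k \<Rightarrow> 'x \<Rightarrow> 'x"
  norm_v :: "'x \<Rightarrow> real"

definition unit_ball :: "('k, 'x) nspace \<Rightarrow> 'x set" where
  "unit_ball X = {x \<in> vecs X. norm_v X x \<le> 1}"

definition unit_sphere :: "('k, 'x) nspace \<Rightarrow> 'x set" where
  "unit_sphere X = {x \<in> vecs X. norm_v X x = 1}"

definition bounded_operator ::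
    "('k, 'x) nspace \<Rightarrow> ('k \<Rightarrow> 'b \<Rightarrow> 'b::banach) \<Rightarrow> ('x \<Rightarrow> 'b) \<Rightarrow> bool" where
  "bounded_operator X smul T \<longleftrightarrow>
     (\<forall>x\<in>vecs X. \<forall>y\<in>vecs X. T (plus_v X x y) = T x + T y) \<and>
     (\<forall>c. \<forall>x\<in>vecs X. T (scale_v X c x) = smul c (T x)) \<and>
     (\<exists>C. \<forall>x\<in>vecs X. norm (T x) \<le> C * norm_v X x)"

definition op_norm :: "('k, 'x) nspace \<Rightarrow> ('x \<Rightarrow> 'b::banach) \<Rightarrow> real" where
  "op_norm X T = (SUP x\<in>unit_ball X. norm (T x))"

definition RSE ::
    "('k::real_or_complex, 'x) nspace \<Rightarrow> ('k \<Rightarrow> 'b \<Rightarrow> 'b::banach) \<Rightarrow> ('x \<Rightarrow> 'b) set" where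
  "RSE X smul =
     {T. bounded_operator X smul T \<and>
         (\<exists>x0\<in>unit_sphere X. \<forall>x::nat \<Rightarrow> 'x.
            (\<forall>n. x n \<in> unit_ball X) \<and> (\<lambda>n. norm (T (x n))) \<longlonglongrightarrow> op_norm X T \<longrightarrow>
            (\<exists>\<sigma>::nat \<Rightarrow> nat. \<exists>\<theta>::'k. strict_mono \<sigma> \<and> norm \<theta> = 1 \<and>
               (\<lambda>n. T (x (\<sigma> n))) \<longlonglongrightarrow> smul \<theta> (T x0)))}"


section \<open>Radon--Nikodym sets and strong Radon--Nikodym operators\<close>

text \<open>
  Open half-spaces are given by nonzero real-linear continuous functionals; in a complex Banach
  space these are exactly the real parts of nonzero complex-linear continuous functionals.
\<close>

definition open_halfspace :: "'b::banach set \<Rightarrow> bool" where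
  "open_halfspace H \<longleftrightarrow>
     (\<exists>(f::'b \<Rightarrow> real) a. bounded_linear f \<and> f \<noteq> (\<lambda>_. 0) \<and> H = {y. a < f y})"

definition slice_of :: "'b::banach set \<Rightarrow> 'b set \<Rightarrow> bool" where
  "slice_of C S \<longleftrightarrow> S \<noteq> {} \<and> (\<exists>H. open_halfspace H \<and> S = C \<inter> H)"

text \<open>
  Boundedness of the slice is required explicitly because \<open>diameter\<close> is a real number and carries no
  information for unbounded sets.
\<close>

definition RNP_set :: "'b::banach set \<Rightarrow> bool" where
  "RNP_set D \<longleftrightarrow> closed D \<and> convex D \<and>
     (\<forall>C. C \<subseteq> D \<and> C \<noteq> {} \<longrightarrow>
        (\<forall>\<epsilon>>0. \<exists>S. slice_of C S \<and> bounded S \<and> diameter S < \<epsilon>))"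

definition strong_RN_operator ::
    "('k, 'x) nspace \<Rightarrow> ('k \<Rightarrow> 'b \<Rightarrow> 'b::banach) \<Rightarrow> ('x \<Rightarrow> 'b) \<Rightarrow> bool" where
  "strong_RN_operator X smul T \<longleftrightarrow>
     bounded_operator X smul T \<and> RNP_set (closure (T ` unit_ball X))"


section \<open>The space \<open>L\<^sub>1(\<mu>)\<close>\<close>

definition ae_rel ::
    "'a measure \<Rightarrow> (('a \<Rightarrow> 'k::real_or_complex) \<times> ('a \<Rightarrow> 'k)) set" where
  "ae_rel M = {(f, g). integrable M f \<and> integrable M g \<and> (AE x in M. f x = g x)}"

definition ae_class :: "'a measure \<Rightarrow> ('a \<Rightarrow> 'k::real_or_complex) \<Rightarrow> ('a \<Rightarrow> 'k) set" where
  "ae_class M f = ae_rel M `` {f}"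

definition rep :: "('a \<Rightarrow> 'k) set \<Rightarrow> 'a \<Rightarrow> 'k" where
  "rep F = (SOME f. f \<in> F)"

definition L1 :: "'a measure \<Rightarrow> ('k::real_or_complex, ('a \<Rightarrow> 'k) set) nspace" where
  "L1 M =
     \<lparr> vecs = {f. integrable M f} // ae_rel M,
       plus_v = (\<lambda>F G. ae_class M (\<lambda>x. rep F x + rep G x)),
       scale_v = (\<lambda>c F. ae_class M (\<lambda>x. c * rep F x)),
       norm_v = (\<lambda>F. \<integral>x. norm (rep F x) \<partial>M) \<rparr>"

text \<open>The operations do not depend on the chosen representatives.\<close>

lemma equiv_ae_rel: "equiv {f. integrable M f} (ae_rel M)"
proof (rule equivI)
  show "ae_rel M \<subseteq> {f. integrable M f} \<times> {f. integrable M f}"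
    by (auto simp: ae_rel_def)
  show "refl_on {f. integrable M f} (ae_rel M)"
    by (auto simp: refl_on_def ae_rel_def)
  show "sym (ae_rel M)"
    by (auto simp: sym_def ae_rel_def elim: AE_mp)
  show "trans (ae_rel M)"
    by (auto simp: trans_def ae_rel_def elim: AE_mp)
qed

lemma vecs_L1: "vecs (L1 M) = ae_class M ` {f. integrable M f}"
  by (auto simp: L1_def quotient_def ae_class_def)

lemma ae_class_eq_iff:
  assumes "integrable M f" "integrable M g"
  shows "ae_class M f = ae_class M g \<longleftrightarrow> (AE x in M. f x = g x)"
  using eq_equiv_class_iff[OF equiv_ae_rel, of f M g] assms
  by (simp add: ae_class_def ae_rel_def)

lemma rep_ae_class:
  assumes "integrable M f"
  shows "integrable M (rep (ae_class M f))" "AE x in M. rep (ae_class M f) x = f x"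
proof -
  have "f \<in> ae_class M f"
    using assms by (simp add: ae_class_def ae_rel_def)
  then have "rep (ae_class M f) \<in> ae_class M f"
    unfolding rep_def by (rule someI[where P = "\<lambda>g. g \<in> ae_class M f"])
  then show "integrable M (rep (ae_class M f))" "AE x in M. rep (ae_class M f) x = f x"
    by (auto simp: ae_class_def ae_rel_def elim: AE_mp)
qed

lemma norm_L1: "integrable M f \<Longrightarrow> norm_v (L1 M) (ae_class M f) = (\<integral>x. norm (f x) \<partial>M)"
  using rep_ae_class[of M f] by (auto simp: L1_def intro!: integral_cong_AE elim: AE_mp)

lemma plus_L1:
  assumes "integrable M f" "integrable M g"
  shows "plus_v (L1 M) (ae_class M f) (ae_class M g) = ae_class M (\<lambda>x. f x + g x)"
proof -
  have "AE x in M. rep (ae_class M f) x + rep (ae_class M g) x = f x + g x"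
    using rep_ae_class(2)[OF assms(1)] rep_ae_class(2)[OF assms(2)] by eventually_elim simp
  then show ?thesis
    using assms by (simp add: L1_def ae_class_eq_iff rep_ae_class)
qed

lemma scale_L1:
  assumes "integrable M f"
  shows "scale_v (L1 M) c (ae_class M f) = ae_class M (\<lambda>x. c * f x)"
proof -
  have "AE x in M. c * rep (ae_class M f) x = c * f x"
    using rep_ae_class(2)[OF assms] by eventually_elim simp
  then show ?thesis
    using assms by (simp add: L1_def ae_class_eq_iff rep_ae_class)
qed

end

theory Submission
  imports Defs
begin

text \<open>
  For a set \<open>A\<close> of positive measure let \<open>avg A = T 1\<^sub>A / \<mu>(A)\<close>, a point of the closed image
  \<open>D\<close> of the unit ball. If \<open>T\<close> were integration against a density \<open>g\<close>, then \<open>avg A\<close> would be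
  the mean of \<open>g\<close> over \<open>A\<close>. The proof produces countably valued approximations of this
  density straight from the averages, without constructing \<open>g\<close>.

  The averages over the subsets of a set \<open>B\<close> of positive measure form a nonempty subset of \<open>D\<close>,
  which has a slice \<open>{l > a}\<close> of small diameter. A subset \<open>A\<close> of \<open>B\<close> with \<open>l (avg A) > a\<close>
  contains a set \<open>E\<close> all of whose subsets of positive measure have their averages in that slice:
  otherwise \<open>A\<close> would be exhausted by disjoint sets \<open>G\<close> with \<open>l (T 1\<^sub>G) \<le> a \<mu>(G)\<close>, and
  countable additivity would give \<open>l (T 1\<^sub>A) \<le> a \<mu>(A)\<close>. So the averages oscillate little on \<open>E\<close>
  (\<open>positive_subset\<close>, \<open>small_oscillation\<close>). Exhausting the whole space by such sets \<open>E\<^sub>n\<close> and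
  putting \<open>y\<^sub>n = avg E\<^sub>n\<close>, one obtains that \<open>T\<close> is uniformly close to
  \<open>f \<mapsto> \<Sum>n. (\<integral>\<^sub>E\<^sub>n f) y\<^sub>n\<close> (\<open>step_approximation\<close>).

  Finally one value \<open>y\<^sub>m\<close> whose norm is almost \<open>s = sup \<parallel>y\<^sub>n\<parallel>\<close> is replaced by \<open>(1 + t) y\<^sub>m\<close>, with
  \<open>t\<close> so small that the operator moves little, but large enough that the new value is strictly
  longer than \<open>s\<close>. A sequence in the unit ball along which the new operator almost attains its
  norm must then concentrate its mass, with asymptotically constant phase along a subsequence,
  on \<open>E\<^sub>m\<close> (\<open>step_almost_norming\<close>), so that its images converge to a unimodular multiple of
  the value at the normalised indicator of \<open>E\<^sub>m\<close>. Since all values are averages up to a factor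
  at most \<open>1 + t\<close>, the image of the ball stays within \<open>(1 + t) D\<close> (\<open>step_avg_in_closure\<close>).
\<close>

section \<open>Exhaustion in a finite measure space\<close>

text \<open>
  The pieces are chosen greedily: each has at least half the largest measure still available
  among the sets satisfying \<open>P\<close>. Their measures tend to zero because they are disjoint, so a
  remainder of positive measure would contain a set that should have been chosen earlier.
\<close>

lemma (in finite_measure) exhaustion:
  assumes "E \<in> sets M"
    and dense: "\<forall>A\<in>sets M. A \<subseteq> E \<longrightarrow> measure M A > 0 \<longrightarrow>
      (\<exists>B\<in>sets M. B \<subseteq> A \<and> measure M B > 0 \<and> P B)"
  shows "\<exists>B :: nat \<Rightarrow> 'a set. (\<forall>n. B n \<in> sets M \<and> B n \<subseteq> E \<and> (B n = {} \<or> measure M (B n) > 0 \<and> P (B n))) \<and>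
    disjoint_family B \<and> measure M (E - (\<Union>n. B n)) = 0"
proof -
  define good where "good B \<longleftrightarrow> B \<in> sets M \<and> measure M B > 0 \<and> P B" for B
  have "\<exists>B. B \<subseteq> R \<and> (B = {} \<or> good B) \<and> (\<forall>B'. good B' \<and> B' \<subseteq> R \<longrightarrow> measure M B' \<le> 2 * measure M B)"
    for R
  proof (cases "\<exists>B. good B \<and> B \<subseteq> R")
    case True
    then obtain B0 where B0: "good B0" "B0 \<subseteq> R" by blast
    define X where "X = measure M ` {B. good B \<and> B \<subseteq> R}"
    have bdd: "bdd_above X"
      unfolding X_def by (intro bdd_aboveI[where M = "measure M (space M)"]) (auto intro: bounded_measure)
    have "measure M B0 \<in> X" unfolding X_def using B0 by blast
    moreover have "measure M B0 > 0" using B0 by (simp add: good_def)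
    ultimately have pos: "Sup X > 0" using bdd cSup_upper[of "measure M B0" X] by linarith
    then have "Sup X / 2 < Sup X" by simp
    then obtain r where "r \<in> X" "Sup X / 2 < r"
      using less_cSup_iff[of X] bdd \<open>measure M B0 \<in> X\<close> by blast
    then obtain B where B: "good B" "B \<subseteq> R" "Sup X / 2 < measure M B"
      unfolding X_def by blast
    have "measure M B' \<le> 2 * measure M B" if "good B'" "B' \<subseteq> R" for B'
    proof -
      have "measure M B' \<le> Sup X"
        using that by (intro cSup_upper bdd) (auto simp: X_def)
      then show ?thesis using B(3) by linarith
    qed
    then show ?thesis using B by blast
  next
    case False
    then show ?thesis by (intro exI[of _ "{}"]) auto
  qed
  then obtain pick where pick: "\<And>R. pick R \<subseteq> R" "\<And>R. pick R = {} \<or> good (pick R)"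
    "\<And>R B'. good B' \<Longrightarrow> B' \<subseteq> R \<Longrightarrow> measure M B' \<le> 2 * measure M (pick R)"
    by metis
  \<comment> \<open>\<open>R n\<close> is what remains of \<open>E\<close> after the first \<open>n\<close> choices\<close>
  define R where "R = rec_nat E (\<lambda>_ X. X - pick X)"
  define B where "B n = pick (R n)" for n
  have R_Suc: "R (Suc n) = R n - B n" for n by (simp add: R_def B_def)
  have R_0: "R 0 = E" by (simp add: R_def)
  have dec: "R n \<subseteq> R m" if "m \<le> n" for m n
    using lift_Suc_antimono_le[of R m n] that R_Suc by blast
  have B_R: "B n \<subseteq> R n" for n unfolding B_def by (rule pick)
  have sets_B: "B n \<in> sets M" for n using pick(2)[of "R n"] by (auto simp: B_def good_def)
  have disj: "disjoint_family B"
  proof -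
    have "B m \<inter> B n = {}" if "m < n" for m n
      using dec[of "Suc m" n] that B_R[of n] R_Suc[of m] by auto
    then show ?thesis
      unfolding disjoint_family_on_def by (metis inf_commute nat_neq_iff)
  qed
  have sub: "B n \<subseteq> E" for n using B_R[of n] dec[of 0 n] R_0 by auto
  have rest: "E - (\<Union>n. B n) \<subseteq> R n" for n
    by (induction n) (auto simp: R_0 R_Suc)
  have "(\<lambda>n. measure M (B n)) \<longlonglongrightarrow> 0"
    using finite_measure_UNION[of B] sets_B disj by (auto intro!: summable_LIMSEQ_zero sums_summable)
  then have lim: "(\<lambda>n. 2 * measure M (B n)) \<longlonglongrightarrow> 0" by (auto intro: tendsto_mult_right_zero)
  have "\<not> measure M (E - (\<Union>n. B n)) > 0"
  proof
    assume "measure M (E - (\<Union>n. B n)) > 0"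
    moreover have "E - (\<Union>n. B n) \<in> sets M" using assms(1) sets_B by auto
    ultimately obtain B' where B': "good B'" "B' \<subseteq> E - (\<Union>n. B n)"
      using dense[rule_format, of "E - (\<Union>n. B n)"] by (auto simp: good_def)
    have "measure M B' \<le> 2 * measure M (B n)" for n
      unfolding B_def using B' rest[of n] by (intro pick(3)) auto
    then have "measure M B' \<le> 0"
      using lim by (intro LIMSEQ_le_const[OF lim]) auto
    then show False using B'(1) by (simp add: good_def)
  qed
  then have null: "measure M (E - (\<Union>n. B n)) = 0"
    using measure_nonneg[of M "E - (\<Union>n. B n)"] by linarith
  have "B n = {} \<or> measure M (B n) > 0 \<and> P (B n)" for n
    using pick(2)[of "R n"] by (auto simp: B_def good_def)
  with sets_B sub disj null show ?thesis by blast
qed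

lemma (in finite_measure) integral_indicator_scaleR:
  fixes c :: "'c::{banach,second_countable_topology}"
  assumes "A \<in> sets M"
  shows "(\<integral>x. indicat_real A x *\<^sub>R c \<partial>M) = measure M A *\<^sub>R c"
  using assms by (subst integral_scaleR_left) (auto simp: less_top[symmetric])


section \<open>Bounded operators on integrable functions\<close>

text \<open>
  Operators act on integrable functions here, and not on their classes. Equality of the values
  at almost everywhere equal functions is a consequence of the norm bound.
\<close>

locale L1_operator = finite_measure M + banach_over smul
  for M :: "'a measure" and smul :: "'k::real_or_complex \<Rightarrow> 'b::banach \<Rightarrow> 'b" +
  fixes U :: "('a \<Rightarrow> 'k) \<Rightarrow> 'b" and C :: real
  assumes U_add: "integrable M f \<Longrightarrow> integrable M g \<Longrightarrow> U (\<lambda>x. f x + g x) = U f + U g"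
    and U_mult: "integrable M f \<Longrightarrow> U (\<lambda>x. c * f x) = smul c (U f)"
    and U_bound: "integrable M f \<Longrightarrow> norm (U f) \<le> C * (\<integral>x. norm (f x) \<partial>M)"
    and C_nonneg: "0 \<le> C"
begin

lemma U_zero: "U (\<lambda>x. 0) = 0"
  using U_mult[of "\<lambda>x. 0" 0] by simp

lemma U_scaleR: "integrable M f \<Longrightarrow> U (\<lambda>x. r *\<^sub>R f x) = r *\<^sub>R U f"
  using U_mult[of f "of_real r"] by (simp add: scaleR_conv_of_real smul_of_real)

lemma U_diff: "integrable M f \<Longrightarrow> integrable M g \<Longrightarrow> U (\<lambda>x. f x - g x) = U f - U g"
  using U_add[of f "\<lambda>x. (-1) *\<^sub>R g x"] U_scaleR[of g "-1"] by simp

lemma U_sum: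
  assumes "\<And>i. i \<in> I \<Longrightarrow> integrable M (f i)"
  shows "U (\<lambda>x. \<Sum>i\<in>I. f i x) = (\<Sum>i\<in>I. U (f i))"
  using assms by (induction I rule: infinite_finite_induct) (auto simp: U_zero U_add)

lemma U_cong_AE:
  assumes "integrable M f" "integrable M g" "AE x in M. f x = g x"
  shows "U f = U g"
proof -
  have "(\<integral>x. norm (f x - g x) \<partial>M) = (\<integral>x. 0 \<partial>M)"
    using assms by (intro integral_cong_AE) (auto elim: AE_mp)
  then show ?thesis
    using U_bound[of "\<lambda>x. f x - g x"] U_diff[of f g] assms by simp
qed

lemma U_tendsto:
  assumes f: "integrable M f" and s: "\<And>n. integrable M (s n)"
    and lim: "\<And>x. x \<in> space M \<Longrightarrow> (\<lambda>n. s n x) \<longlonglongrightarrow> f x"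
    and dom: "\<And>n x. x \<in> space M \<Longrightarrow> norm (s n x) \<le> 2 * norm (f x)"
  shows "(\<lambda>n. U (s n)) \<longlonglongrightarrow> U f" "(\<lambda>n. \<integral>x. norm (s n x) \<partial>M) \<longlonglongrightarrow> (\<integral>x. norm (f x) \<partial>M)"
proof -
  have "(\<lambda>n. \<integral>x. norm (s n x - f x) \<partial>M) \<longlonglongrightarrow> (\<integral>x. 0 \<partial>M)"
  proof (rule integral_dominated_convergence[where w = "\<lambda>x. 3 * norm (f x)"])
    show "AE x in M. (\<lambda>n. norm (s n x - f x)) \<longlonglongrightarrow> 0"
      using lim by (intro AE_I2) (simp add: LIM_zero tendsto_norm_zero)
    show "AE x in M. norm (norm (s n x - f x)) \<le> 3 * norm (f x)" for n
    proof (intro AE_I2)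
      fix x assume "x \<in> space M"
      with dom[of x n] norm_triangle_ineq4[of "s n x" "f x"]
      show "norm (norm (s n x - f x)) \<le> 3 * norm (f x)" by simp
    qed
  qed (use f s in auto)
  then have lim_C: "(\<lambda>n. C * (\<integral>x. norm (s n x - f x) \<partial>M)) \<longlonglongrightarrow> 0"
    by (auto intro: tendsto_mult_right_zero)
  have le: "norm (U (s n) - U f) \<le> C * (\<integral>x. norm (s n x - f x) \<partial>M)" for n
    using U_bound[of "\<lambda>x. s n x - f x"] U_diff[of "s n" f] f s by simp
  have "(\<lambda>n. U (s n) - U f) \<longlonglongrightarrow> 0"
    by (rule Lim_null_comparison[OF always_eventually[OF allI[OF le]] lim_C])
  then show "(\<lambda>n. U (s n)) \<longlonglongrightarrow> U f" by (rule LIM_zero_cancel)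
  show "(\<lambda>n. \<integral>x. norm (s n x) \<partial>M) \<longlonglongrightarrow> (\<integral>x. norm (f x) \<partial>M)"
    by (rule integral_dominated_convergence[where w = "\<lambda>x. 2 * norm (f x)"])
      (use f s dom in \<open>auto intro!: AE_I2 tendsto_norm lim\<close>)
qed

lemma integrable_restrict:
  fixes f :: "'a \<Rightarrow> 'c::{banach,second_countable_topology}"
  shows "integrable M f \<Longrightarrow> A \<in> sets M \<Longrightarrow> integrable M (\<lambda>x. indicat_real A x *\<^sub>R f x)"
  by (rule integrable_mult_indicator)

lemma U_sums:
  assumes E: "\<And>n. E n \<in> sets M" and disj: "disjoint_family E"
    and f: "integrable M f" and supp: "AE x in M. f x \<noteq> 0 \<longrightarrow> x \<in> (\<Union>n. E n)"
  shows "(\<lambda>n. U (\<lambda>x. indicat_real (E n) x *\<^sub>R f x)) sums U f"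
proof -
  have Un: "(\<Union>n<N. E n) \<in> sets M" "(\<Union>n. E n) \<in> sets M" for N :: nat using E by auto
  have partial: "(\<Sum>n<N. U (\<lambda>x. indicat_real (E n) x *\<^sub>R f x))
      = U (\<lambda>x. indicat_real (\<Union>n<N. E n) x *\<^sub>R f x)" for N
  proof (induction N)
    case 0
    then show ?case by (simp add: U_zero)
  next
    case (Suc N)
    have "E N \<inter> (\<Union>n<N. E n) = {}"
      using disj unfolding disjoint_family_on_def by (metis UN_E disjoint_iff lessThan_iff nat_neq_iff UNIV_I)
    then have "indicat_real (\<Union>n<Suc N. E n) x = indicat_real (\<Union>n<N. E n) x + indicat_real (E N) x" for x
      by (auto simp: lessThan_Suc indicator_def)
    then show ?case
      using Suc Un(1)[of N] E f by (simp add: scaleR_add_left U_add integrable_restrict)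
  qed
  define g where "g x = indicat_real (\<Union>n. E n) x *\<^sub>R f x" for x
  have g: "integrable M g" unfolding g_def using Un f by (intro integrable_restrict)
  have "U g = U f"
    using supp by (intro U_cong_AE g f) (auto simp: g_def indicator_def elim: AE_mp)
  moreover have "(\<lambda>N. U (\<lambda>x. indicat_real (\<Union>n<N. E n) x *\<^sub>R f x)) \<longlonglongrightarrow> U g"
  proof (rule U_tendsto(1)[OF g])
    show "integrable M (\<lambda>x. indicat_real (\<Union>n<N. E n) x *\<^sub>R f x)" for N
      using Un f by (intro integrable_restrict)
    show "(\<lambda>N. indicat_real (\<Union>n<N. E n) x *\<^sub>R f x) \<longlonglongrightarrow> g x" for x
      unfolding g_def using LIMSEQ_indicator_UN[of E x] by (intro tendsto_intros)
    show "norm (indicat_real (\<Union>n<N. E n) x *\<^sub>R f x) \<le> 2 * norm (g x)" for N x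
      by (auto simp: g_def indicator_def)
  qed
  ultimately show ?thesis
    unfolding sums_def partial by simp
qed

abbreviation one_on :: "'a set \<Rightarrow> 'a \<Rightarrow> 'k" where
  "one_on A \<equiv> \<lambda>x. indicat_real A x *\<^sub>R 1"

lemma integrable_one_on: "A \<in> sets M \<Longrightarrow> integrable M (one_on A)"
  by (rule integrable_restrict) simp

lemma integral_norm_one_on: "A \<in> sets M \<Longrightarrow> (\<integral>x. norm (one_on A x) \<partial>M) = measure M A"
  by simp

text \<open>
  A simple function is a combination of indicators of disjoint sets, so the triangle inequality
  loses nothing on the right-hand side; simple functions are dense.
\<close>

lemma U_norm_le_of_one_on:
  assumes small: "\<And>A. A \<in> sets M \<Longrightarrow> norm (U (one_on A)) \<le> \<epsilon> * measure M A"
    and f: "integrable M f"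
  shows "norm (U f) \<le> \<epsilon> * (\<integral>x. norm (f x) \<partial>M)"
proof -
  have simple: "norm (U s) \<le> \<epsilon> * (\<integral>x. norm (s x) \<partial>M)"
    if s: "simple_function M s" and "integrable M s" for s
  proof -
    define A where "A y = s -` {y} \<inter> space M" for y
    have A: "A y \<in> sets M" for y unfolding A_def by (rule simple_functionD(2)[OF s])
    define t where "t x = (\<Sum>y\<in>s ` space M. y * one_on (A y) x)" for x
    have st: "s x = t x" if "x \<in> space M" for x
    proof -
      have "s x = (\<Sum>y\<in>s ` space M. indicat_real (s -` {y} \<inter> space M) x *\<^sub>R y)"
        by (rule simple_function_indicator_representation_banach[OF s that])
      also have "\<dots> = t x"
        unfolding t_def A_def by (intro sum.cong refl) simp
      finally show ?thesis .
    qed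
    have fin: "finite (s ` space M)" using s by (simp add: simple_function_def)
    have t: "integrable M t"
      unfolding t_def
      by (intro Bochner_Integration.integrable_sum integrable_mult_right integrable_one_on A)
    have "U s = U t"
      using st that(2) t by (intro U_cong_AE) auto
    also have "\<dots> = (\<Sum>y\<in>s ` space M. smul y (U (one_on (A y))))"
      unfolding t_def using A by (simp add: U_sum U_mult integrable_one_on del: mult_scaleR_right)
    also have "norm \<dots> \<le> (\<Sum>y\<in>s ` space M. norm y * (\<epsilon> * measure M (A y)))"
      using small A by (intro sum_norm_le) (auto simp: norm_smul intro!: mult_left_mono)
    also have "\<dots> = \<epsilon> * (\<Sum>y\<in>s ` space M. measure M (A y) * norm y)"
      by (simp add: sum_distrib_left algebra_simps)
    also have "(\<Sum>y\<in>s ` space M. measure M (A y) * norm y)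
        = (\<integral>x. (\<Sum>y\<in>s ` space M. indicat_real (A y) x * norm y) \<partial>M)"
      using A by (subst Bochner_Integration.integral_sum) (auto intro!: integrable_mult_left simp: less_top[symmetric])
    also have "\<dots> = (\<integral>x. norm (s x) \<partial>M)"
    proof (intro Bochner_Integration.integral_cong refl)
      fix x assume x: "x \<in> space M"
      have "(\<Sum>y\<in>s ` space M. indicat_real (A y) x * norm y)
          = (\<Sum>y\<in>s ` space M. if y = s x then norm y else 0)"
        using x by (intro sum.cong) (auto simp: A_def indicator_def)
      then show "(\<Sum>y\<in>s ` space M. indicat_real (A y) x * norm y) = norm (s x)"
        using x fin by simp
    qed
    finally show ?thesis .
  qed
  obtain s where s: "\<And>i. simple_function M (s i)" "\<And>i. emeasure M {y \<in> space M. s i y \<noteq> 0} \<noteq> \<infinity>"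
    "\<And>x. x \<in> space M \<Longrightarrow> (\<lambda>i. s i x) \<longlonglongrightarrow> f x"
    "\<And>x i. x \<in> space M \<Longrightarrow> norm (s i x) \<le> 2 * norm (f x)"
    using integrable_implies_simple_function_sequence[OF f] by blast
  have int: "integrable M (s i)" for i
    using s by (intro integrable_simple_function)
  have "(\<lambda>i. norm (U (s i))) \<longlonglongrightarrow> norm (U f)"
    "(\<lambda>i. \<epsilon> * (\<integral>x. norm (s i x) \<partial>M)) \<longlonglongrightarrow> \<epsilon> * (\<integral>x. norm (f x) \<partial>M)"
    using U_tendsto[OF f int s(3,4)] by (auto intro: tendsto_intros)
  then show ?thesis
    using simple[OF s(1) int] by (intro LIMSEQ_le) auto
qed


text \<open>
  At a null set the division by zero gives the value 0, so that the bound for averages holds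
  for all measurable sets and empty pieces need no separate treatment in the kernels below.
\<close>

definition avg :: "'a set \<Rightarrow> 'b" where
  "avg A = (1 / measure M A) *\<^sub>R U (one_on A)"

lemma U_one_on: "A \<in> sets M \<Longrightarrow> U (one_on A) = measure M A *\<^sub>R avg A"
  using U_bound[of "one_on A"] by (cases "measure M A = 0") (auto simp: avg_def integrable_one_on)

lemma norm_avg_le:
  assumes "A \<in> sets M"
  shows "norm (avg A) \<le> C"
proof (cases "measure M A = 0")
  case False
  then have "measure M A > 0" using measure_nonneg[of M A] by linarith
  then show ?thesis
    using U_bound[of "one_on A"] assms
    by (simp add: avg_def integrable_one_on divide_simps mult.commute)
qed (simp add: avg_def C_nonneg)

lemma avg_scaleR_eq:
  assumes "A \<in> sets M"
  shows "smul a (c *\<^sub>R avg A) = U (\<lambda>x. (a * of_real (c / measure M A)) * one_on A x)"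
proof -
  have "smul a (c *\<^sub>R avg A) = smul a (smul (of_real (c / measure M A)) (U (one_on A)))"
    by (simp only: avg_def smul_of_real) simp
  also have "\<dots> = U (\<lambda>x. (a * of_real (c / measure M A)) * one_on A x)"
    by (simp only: scale_scale U_mult[OF integrable_one_on[OF assms]])
  finally show ?thesis .
qed

lemma disjoint_cover_one_on:
  assumes B: "\<And>n. B n \<in> sets M" "disjoint_family B" and A: "A \<in> sets M"
    and null: "measure M (A - (\<Union>n. B n)) = 0"
  shows "(\<lambda>n. U (one_on (B n \<inter> A))) sums U (one_on A)"
    "(\<lambda>n. measure M (B n \<inter> A)) sums measure M A"
proof -
  have "A - (\<Union>n. B n) \<in> null_sets M"
    using null A B(1) by (auto simp: null_sets_def emeasure_eq_measure)
  then have AE: "AE x in M. x \<notin> A - (\<Union>n. B n)" by (rule AE_not_in)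
  have "(\<lambda>n. U (\<lambda>x. indicat_real (B n) x *\<^sub>R one_on A x)) sums U (one_on A)"
    using AE by (intro U_sums B integrable_one_on A) (auto simp: indicator_def elim: AE_mp)
  then show "(\<lambda>n. U (one_on (B n \<inter> A))) sums U (one_on A)"
    by (simp add: indicator_inter_arith)
  have "(\<lambda>n. measure M (B n \<inter> A)) sums measure M (\<Union>n. B n \<inter> A)"
    using B A by (intro finite_measure_UNION) (auto simp: disjoint_family_on_def)
  moreover have "measure M (\<Union>n. B n \<inter> A) = measure M A"
  proof (rule finite_measure_eq_AE)
    show "AE x in M. x \<in> (\<Union>n. B n \<inter> A) \<longleftrightarrow> x \<in> A"
      using AE by eventually_elim blast
  qed (use A B(1) in auto)
  ultimately show "(\<lambda>n. measure M (B n \<inter> A)) sums measure M A" by simp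
qed

text \<open>
  This plays the role of a Hahn decomposition for the signed measure
  \<open>A \<mapsto> l (U 1\<^sub>A) - a \<mu>(A)\<close>. It rests on exhaustion instead: if every subset of \<open>A\<close> of positive
  measure contained a set of positive measure violating the strict inequality, then \<open>A\<close> would be
  a disjoint union of violating sets up to a null set, and would itself violate it.
\<close>

lemma positive_subset:
  assumes l: "bounded_linear l" and A: "A \<in> sets M"
    and gt: "l (U (one_on A)) > a * measure M A"
  shows "\<exists>B\<in>sets M. B \<subseteq> A \<and> measure M B > 0 \<and>
    (\<forall>G\<in>sets M. G \<subseteq> B \<longrightarrow> measure M G > 0 \<longrightarrow> l (U (one_on G)) > a * measure M G)"
proof (rule ccontr)
  interpret l: bounded_linear l by (rule l)
  assume "\<not> ?thesis"
  then have dense: "\<forall>B\<in>sets M. B \<subseteq> A \<longrightarrow> measure M B > 0 \<longrightarrow>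
      (\<exists>G\<in>sets M. G \<subseteq> B \<and> measure M G > 0 \<and> l (U (one_on G)) \<le> a * measure M G)"
    by (meson not_le)
  obtain G :: "nat \<Rightarrow> 'a set" where G0: "\<forall>n. G n \<in> sets M \<and> G n \<subseteq> A \<and>
      (G n = {} \<or> measure M (G n) > 0 \<and> l (U (one_on (G n))) \<le> a * measure M (G n))"
    and disj: "disjoint_family G" and null: "measure M (A - (\<Union>n. G n)) = 0"
    using exhaustion[where P = "\<lambda>G. l (U (one_on G)) \<le> a * measure M G", OF A dense]
    by (elim exE conjE)
  have sets_G: "G n \<in> sets M" for n using G0 by blast
  note cover = disjoint_cover_one_on[OF sets_G disj A null]
  have GA: "G n \<inter> A = G n" for n using G0 by blast
  have "(\<lambda>n. l (U (one_on (G n)))) sums l (U (one_on A))"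
    using l.sums[OF cover(1)] by (simp add: GA)
  moreover have "(\<lambda>n. a * measure M (G n)) sums (a * measure M A)"
    using sums_mult[OF cover(2)] by (simp add: GA)
  moreover have "l (U (one_on (G n))) \<le> a * measure M (G n)" for n
    using G0[rule_format, of n] by (auto simp: U_zero l.zero)
  ultimately have "l (U (one_on A)) \<le> a * measure M A"
    by (rule sums_le[rotated])
  then show False using gt by simp
qed

text \<open>
  Here dentability enters: a small slice of the set of averages over subsets of \<open>B\<close> contains all
  averages over subsets of a suitable \<open>E\<close>, because the half-space condition on an average is a
  positivity condition in the sense of the preceding lemma.
\<close>

lemma small_oscillation:
  assumes D: "RNP_set D"
    and avg_D: "\<And>A. A \<in> sets M \<Longrightarrow> measure M A > 0 \<Longrightarrow> avg A \<in> D"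
    and B: "B \<in> sets M" "measure M B > 0" and "\<epsilon> > 0"
  obtains E where "E \<in> sets M" "E \<subseteq> B" "measure M E > 0"
    "\<And>A. A \<in> sets M \<Longrightarrow> A \<subseteq> E \<Longrightarrow> measure M A > 0 \<Longrightarrow> norm (avg A - avg E) \<le> \<epsilon>"
proof -
  define R where "R = avg ` {A \<in> sets M. A \<subseteq> B \<and> measure M A > 0}"
  have "R \<subseteq> D" "R \<noteq> {}" unfolding R_def using avg_D B by auto
  then obtain S where S: "slice_of R S" "bounded S" "diameter S < \<epsilon>"
    using D \<open>\<epsilon> > 0\<close> unfolding RNP_set_def by meson
  then obtain l :: "'b \<Rightarrow> real" and a where l: "bounded_linear l" and S_eq: "S = R \<inter> {y. a < l y}" and "S \<noteq> {}"
    unfolding slice_of_def open_halfspace_def by auto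
  interpret l: bounded_linear l by (rule l)
  have l_avg: "l (U (one_on A)) > a * measure M A \<longleftrightarrow> l (avg A) > a"
    if "A \<in> sets M" "measure M A > 0" for A
    using that by (simp add: U_one_on l.scaleR mult.commute)
  obtain A where A: "A \<in> sets M" "A \<subseteq> B" "measure M A > 0" "l (avg A) > a"
    using \<open>S \<noteq> {}\<close> unfolding S_eq R_def by auto
  then obtain E where E: "E \<in> sets M" "E \<subseteq> A" "measure M E > 0"
    "\<And>G. G \<in> sets M \<Longrightarrow> G \<subseteq> E \<Longrightarrow> measure M G > 0 \<Longrightarrow> l (U (one_on G)) > a * measure M G"
    using positive_subset[OF l A(1), of a] l_avg[OF A(1,3)] by blast
  have in_S: "avg G \<in> S" if "G \<in> sets M" "G \<subseteq> E" "measure M G > 0" for G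
    using E(2) E(4)[OF that] l_avg[OF that(1,3)] A(2) that unfolding S_eq R_def by auto
  have "norm (avg G - avg E) \<le> \<epsilon>" if "G \<in> sets M" "G \<subseteq> E" "measure M G > 0" for G
    using diameter_bounded_bound[OF S(2) in_S[OF that] in_S[OF E(1) _ E(3)]] S(3)
    by (simp add: dist_norm)
  then show thesis using that[of E] E A(2) by auto
qed

end


section \<open>Countably valued kernels\<close>

text \<open>Integration against the kernel that takes the value \<open>z n\<close> on \<open>E n\<close>.\<close>

definition step_operator ::
    "'a measure \<Rightarrow> ('k::real_or_complex \<Rightarrow> 'b \<Rightarrow> 'b::banach) \<Rightarrow> (nat \<Rightarrow> 'a set) \<Rightarrow> (nat \<Rightarrow> 'b) \<Rightarrow> ('a \<Rightarrow> 'k) \<Rightarrow> 'b"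
  where "step_operator M smul E z f = (\<Sum>n. smul (\<integral>x. indicat_real (E n) x *\<^sub>R f x \<partial>M) (z n))"

locale disjoint_pieces = finite_measure M + banach_over smul
  for M :: "'a measure" and smul :: "'k::real_or_complex \<Rightarrow> 'b::banach \<Rightarrow> 'b" +
  fixes E :: "nat \<Rightarrow> 'a set"
  assumes sets_E: "E n \<in> sets M" and disjoint_E: "disjoint_family E"
begin

abbreviation coeff :: "nat \<Rightarrow> ('a \<Rightarrow> 'k) \<Rightarrow> 'k" where
  "coeff n f \<equiv> \<integral>x. indicat_real (E n) x *\<^sub>R f x \<partial>M"

abbreviation step :: "(nat \<Rightarrow> 'b) \<Rightarrow> ('a \<Rightarrow> 'k) \<Rightarrow> 'b" where
  "step \<equiv> step_operator M smul E"

lemma sum_norm_coeff_le: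
  assumes f: "integrable M f" and "finite I"
  shows "(\<Sum>n\<in>I. norm (coeff n f)) \<le> (\<integral>x. norm (f x) \<partial>M)"
proof -
  have int: "integrable M (\<lambda>x. indicat_real (E n) x *\<^sub>R norm (f x))" for n
    using f sets_E by (intro integrable_mult_indicator) auto
  have "(\<Sum>n\<in>I. norm (coeff n f)) \<le> (\<Sum>n\<in>I. \<integral>x. indicat_real (E n) x *\<^sub>R norm (f x) \<partial>M)"
  proof (rule sum_mono)
    fix n
    have "norm (coeff n f) \<le> (\<integral>x. norm (indicat_real (E n) x *\<^sub>R f x) \<partial>M)"
      by (rule integral_norm_bound)
    then show "norm (coeff n f) \<le> (\<integral>x. indicat_real (E n) x *\<^sub>R norm (f x) \<partial>M)"
      by simp
  qed
  also have "\<dots> = (\<integral>x. (\<Sum>n\<in>I. indicat_real (E n) x *\<^sub>R norm (f x)) \<partial>M)"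
    using int by (intro Bochner_Integration.integral_sum[symmetric])
  also have "\<dots> \<le> (\<integral>x. norm (f x) \<partial>M)"
  proof (intro integral_mono Bochner_Integration.integrable_sum int integrable_norm f)
    fix x
    have "disjoint_family_on E I"
      using disjoint_E by (rule disjoint_family_on_mono[rotated]) simp
    then have "(\<Sum>n\<in>I. indicat_real (E n) x) = indicat_real (\<Union>n\<in>I. E n) x"
      using \<open>finite I\<close> by (rule indicator_UN_disjoint[symmetric, rotated])
    also have "\<dots> \<le> 1" by (rule indicator_le_1)
    finally show "(\<Sum>n\<in>I. indicat_real (E n) x *\<^sub>R norm (f x)) \<le> norm (f x)"
      using mult_right_mono[of "\<Sum>n\<in>I. indicat_real (E n) x" 1 "norm (f x)"]
      by (simp add: sum_distrib_right)
  qed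
  finally show ?thesis .
qed

lemma sums_step:
  assumes z: "\<And>n. norm (z n) \<le> K" and f: "integrable M f"
  shows "(\<lambda>n. smul (coeff n f) (z n)) sums step z f"
proof -
  have "summable (\<lambda>n. norm (coeff n f))"
    using sum_norm_coeff_le[OF f] by (intro summableI_nonneg_bounded) auto
  then have "summable (\<lambda>n. norm (coeff n f) * K)" by (rule summable_mult2)
  then have "summable (\<lambda>n. smul (coeff n f) (z n))"
  proof (rule summable_comparison_test'[where N = 0])
    show "norm (smul (coeff n f) (z n)) \<le> norm (coeff n f) * K" for n
      unfolding norm_smul using z by (intro mult_left_mono) auto
  qed
  then show ?thesis
    unfolding step_operator_def by (rule summable_sums)
qed

text \<open>
  The pieces other than \<open>E m\<close> carry at most the mass \<open>\<parallel>f\<parallel> - \<bar>\<integral>\<^sub>E\<^sub>m f\<bar>\<close>, which is all that can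
  move the image away from the line through \<open>z m\<close>.
\<close>

lemma step_deviation:
  assumes z: "\<And>n. n \<noteq> m \<Longrightarrow> norm (z n) \<le> s" and "0 \<le> s" and f: "integrable M f"
  shows "norm (step z f - smul (coeff m f) (z m)) \<le> s * ((\<integral>x. norm (f x) \<partial>M) - norm (coeff m f))"
proof -
  have "norm (z n) \<le> max s (norm (z m))" for n using z[of n] by (cases "n = m") auto
  then have "(\<lambda>n. smul (coeff n f) (z n)) sums step z f" using f by (rule sums_step)
  moreover have "(\<lambda>n. if n = m then smul (coeff n f) (z n) else 0) sums smul (coeff m f) (z m)"
    by (rule sums_single)
  ultimately have "(\<lambda>n. smul (coeff n f) (z n) - (if n = m then smul (coeff n f) (z n) else 0)) sums
      (step z f - smul (coeff m f) (z m))"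
    by (rule sums_diff)
  then have lim: "(\<lambda>N. norm (\<Sum>n<N. smul (coeff n f) (z n) - (if n = m then smul (coeff n f) (z n) else 0)))
      \<longlonglongrightarrow> norm (step z f - smul (coeff m f) (z m))"
    unfolding sums_def by (rule tendsto_norm)
  have "norm (\<Sum>n<N. smul (coeff n f) (z n) - (if n = m then smul (coeff n f) (z n) else 0))
      \<le> s * ((\<integral>x. norm (f x) \<partial>M) - norm (coeff m f))" for N
  proof -
    define J where "J = {..<N} - {m}"
    have "norm (\<Sum>n<N. smul (coeff n f) (z n) - (if n = m then smul (coeff n f) (z n) else 0))
        = norm (\<Sum>n\<in>J. smul (coeff n f) (z n))"
      by (intro arg_cong[where f = norm] sum.mono_neutral_cong_right) (auto simp: J_def)
    also have "\<dots> \<le> (\<Sum>n\<in>J. s * norm (coeff n f))"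
    proof (rule sum_norm_le)
      fix n assume "n \<in> J"
      then show "norm (smul (coeff n f) (z n)) \<le> s * norm (coeff n f)"
        unfolding J_def using z[of n] mult_right_mono[of "norm (z n)" s "norm (coeff n f)"]
        by (simp add: norm_smul mult.commute)
    qed
    also have "\<dots> = s * ((\<Sum>n\<in>insert m J. norm (coeff n f)) - norm (coeff m f))"
      by (simp add: J_def sum_distrib_left del: insert_Diff_single)
    also have "\<dots> \<le> s * ((\<integral>x. norm (f x) \<partial>M) - norm (coeff m f))"
      using sum_norm_coeff_le[OF f, of "insert m J"] \<open>0 \<le> s\<close>
      by (intro mult_left_mono diff_right_mono) (auto simp: J_def)
    finally show ?thesis .
  qed
  then show ?thesis by (intro LIMSEQ_le_const2[OF lim]) auto
qed

lemma norm_step_le: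
  assumes z: "\<And>n. norm (z n) \<le> K" and f: "integrable M f"
  shows "norm (step z f) \<le> K * (\<integral>x. norm (f x) \<partial>M)"
proof -
  have "0 \<le> K" using z[of 0] norm_ge_zero order_trans by blast
  then have "norm (step z f - smul (coeff 0 f) (z 0)) \<le> K * ((\<integral>x. norm (f x) \<partial>M) - norm (coeff 0 f))"
    using z f by (intro step_deviation)
  moreover have "norm (smul (coeff 0 f) (z 0)) \<le> K * norm (coeff 0 f)"
    using mult_right_mono[OF z[of 0], of "norm (coeff 0 f)"] by (simp add: norm_smul mult.commute)
  ultimately show ?thesis
    using norm_triangle_sub[of "step z f" "smul (coeff 0 f) (z 0)"] by (simp add: algebra_simps)
qed

lemma smul_scaleR: "smul a (r *\<^sub>R y) = r *\<^sub>R smul a y"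
  by (simp flip: smul_of_real add: mult.commute)

lemma step_scaleR:
  assumes z: "\<And>n. norm (z n) \<le> K" and f: "integrable M f"
  shows "step (\<lambda>n. r *\<^sub>R z n) f = r *\<^sub>R step z f"
proof -
  have "(\<lambda>n. r *\<^sub>R smul (coeff n f) (z n)) sums (r *\<^sub>R step z f)"
    using sums_step[OF z f] by (rule sums_scaleR_right)
  then show ?thesis
    by (simp add: step_operator_def smul_scaleR sums_unique[symmetric])
qed

lemma step_diff:
  assumes z: "\<And>n. norm (z n) \<le> K" and w: "\<And>n. norm (w n) \<le> L" and f: "integrable M f"
  shows "step (\<lambda>n. z n - w n) f = step z f - step w f"
  using sums_diff[OF sums_step[OF z f] sums_step[OF w f]]
  by (simp add: step_operator_def scale_right_diff_distrib sums_unique[symmetric])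

lemma coeff_add:
  "integrable M f \<Longrightarrow> integrable M g \<Longrightarrow> coeff n (\<lambda>x. f x + g x) = coeff n f + coeff n g"
  using sets_E by (simp add: scaleR_add_right integrable_mult_indicator)

lemma coeff_mult: "coeff n (\<lambda>x. c * f x) = c * coeff n f"
  by (simp flip: mult_scaleR_right)

lemma L1_operator_step:
  assumes z: "\<And>n. norm (z n) \<le> K"
  shows "L1_operator M smul (step z) K"
proof
  fix f g :: "'a \<Rightarrow> 'k" assume f: "integrable M f" and g: "integrable M g"
  then have "(\<lambda>n. smul (coeff n (\<lambda>x. f x + g x)) (z n)) sums (step z f + step z g)"
    using sums_add[OF sums_step[OF z f] sums_step[OF z g]]
    by (simp add: coeff_add scale_left_distrib)
  then show "step z (\<lambda>x. f x + g x) = step z f + step z g"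
    unfolding step_operator_def by (rule sums_unique[symmetric])
next
  fix f :: "'a \<Rightarrow> 'k" and c assume f: "integrable M f"
  have "bounded_linear (smul c)"
  proof (rule bounded_linear_intro[where K = "norm c"])
  qed (simp_all add: smul_scaleR scale_right_distrib norm_smul mult.commute)
  from bounded_linear.sums[OF this sums_step[OF z f]]
  have "(\<lambda>n. smul (coeff n (\<lambda>x. c * f x)) (z n)) sums smul c (step z f)"
    unfolding coeff_mult by simp
  then show "step z (\<lambda>x. c * f x) = smul c (step z f)"
    unfolding step_operator_def by (rule sums_unique[symmetric])
next
  fix f :: "'a \<Rightarrow> 'k" assume "integrable M f"
  then show "norm (step z f) \<le> K * (\<integral>x. norm (f x) \<partial>M)" using z by (intro norm_step_le)
next
  show "0 \<le> K" using z[of 0] norm_ge_zero order_trans by blast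
qed

text \<open>
  Write \<open>a i = \<integral>\<^sub>E\<^sub>m (f i)\<close>. By the deviation estimate, the norm of the image of \<open>f i\<close> is at most
  \<open>\<bar>a i\<bar> \<parallel>z m\<parallel> + s (1 - \<bar>a i\<bar>)\<close>. As \<open>s < \<parallel>z m\<parallel>\<close>, almost norming forces \<open>\<bar>a i\<bar>\<close> to tend to 1, and
  then the image is asymptotically \<open>a i\<close> times \<open>z m\<close>. Compactness of the scalar unit ball
  provides the limit phase.
\<close>

lemma step_almost_norming:
  assumes z: "\<And>n. n \<noteq> m \<Longrightarrow> norm (z n) \<le> s" and "0 \<le> s" "s < norm (z m)"
    and f: "\<And>i. integrable M (f i)" "\<And>i. (\<integral>x. norm (f i x) \<partial>M) \<le> 1"
    and lim: "(\<lambda>i. norm (step z (f i))) \<longlonglongrightarrow> norm (z m)"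
  obtains \<sigma> :: "nat \<Rightarrow> nat" and \<theta> :: 'k
  where "strict_mono \<sigma>" "norm \<theta> = 1" "(\<lambda>i. step z (f (\<sigma> i))) \<longlonglongrightarrow> smul \<theta> (z m)"
proof -
  define a where "a i = coeff m (f i)" for i
  have dev: "norm (step z (f i) - smul (a i) (z m)) \<le> s * (1 - norm (a i))" for i
  proof -
    have "norm (step z (f i) - smul (a i) (z m)) \<le> s * ((\<integral>x. norm (f i x) \<partial>M) - norm (a i))"
      unfolding a_def using z \<open>0 \<le> s\<close> f(1) by (rule step_deviation)
    also have "\<dots> \<le> s * (1 - norm (a i))"
      using f(2)[of i] \<open>0 \<le> s\<close> by (intro mult_left_mono) auto
    finally show ?thesis .
  qed
  have a_le: "norm (a i) \<le> 1" for i
    using sum_norm_coeff_le[OF f(1), of "{m}" i] f(2)[of i] by (simp add: a_def)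
  have gap: "1 - norm (a i) \<le> (norm (z m) - norm (step z (f i))) / (norm (z m) - s)" for i
  proof -
    have "norm (step z (f i)) \<le> norm (a i) * norm (z m) + s * (1 - norm (a i))"
      using norm_triangle_sub[of "step z (f i)" "smul (a i) (z m)"] dev[of i] by (simp add: norm_smul)
    then have "(1 - norm (a i)) * (norm (z m) - s) \<le> norm (z m) - norm (step z (f i))"
      by (simp add: algebra_simps)
    then show ?thesis using \<open>s < norm (z m)\<close> by (simp add: pos_le_divide_eq)
  qed
  have "(\<lambda>i. (norm (z m) - norm (step z (f i))) / (norm (z m) - s)) \<longlonglongrightarrow>
      (norm (z m) - norm (z m)) / (norm (z m) - s)"
    using \<open>s < norm (z m)\<close> by (intro tendsto_intros lim) auto
  then have lim_gap: "(\<lambda>i. (norm (z m) - norm (step z (f i))) / (norm (z m) - s)) \<longlonglongrightarrow> 0"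
    by simp
  have defect: "(\<lambda>i. 1 - norm (a i)) \<longlonglongrightarrow> 0"
  proof (rule Lim_null_comparison[OF always_eventually[OF allI] lim_gap])
    show "norm (1 - norm (a i)) \<le> (norm (z m) - norm (step z (f i))) / (norm (z m) - s)" for i
      using gap[of i] a_le[of i] by simp
  qed
  obtain \<theta> \<sigma> where \<sigma>: "strict_mono \<sigma>" and \<theta>: "(a \<circ> \<sigma>) \<longlonglongrightarrow> \<theta>"
    using compact_cball[of "0::'k" 1] a_le unfolding compact_def by (metis mem_cball_0)
  have defect_\<sigma>: "(\<lambda>i. 1 - norm (a (\<sigma> i))) \<longlonglongrightarrow> 0"
    using LIMSEQ_subseq_LIMSEQ[OF defect \<sigma>] by (simp add: o_def)
  moreover have "(\<lambda>i. 1 - norm (a (\<sigma> i))) \<longlonglongrightarrow> 1 - norm \<theta>"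
    using \<theta> by (intro tendsto_intros) (simp add: o_def)
  ultimately have "norm \<theta> = 1"
    using LIMSEQ_unique by fastforce
  have "(\<lambda>i. s * (1 - norm (a (\<sigma> i)))) \<longlonglongrightarrow> 0"
    using defect_\<sigma> by (rule tendsto_mult_right_zero)
  then have "(\<lambda>i. step z (f (\<sigma> i)) - smul (a (\<sigma> i)) (z m)) \<longlonglongrightarrow> 0"
    by (rule Lim_null_comparison[OF always_eventually[OF allI[OF dev]]])
  moreover have "(\<lambda>i. smul (a (\<sigma> i)) (z m) - smul \<theta> (z m)) \<longlonglongrightarrow> 0"
  proof (rule Lim_null_comparison[OF always_eventually])
    show "\<forall>i. norm (smul (a (\<sigma> i)) (z m) - smul \<theta> (z m)) \<le> norm (a (\<sigma> i) - \<theta>) * norm (z m)"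
      unfolding scale_left_diff_distrib[symmetric] norm_smul by simp
    show "(\<lambda>i. norm (a (\<sigma> i) - \<theta>) * norm (z m)) \<longlonglongrightarrow> 0"
      using \<theta> by (intro tendsto_mult_left_zero tendsto_norm_zero LIM_zero) (simp add: o_def)
  qed
  ultimately have "(\<lambda>i. step z (f (\<sigma> i)) - smul \<theta> (z m)) \<longlonglongrightarrow> 0"
    using tendsto_add by fastforce
  then have "(\<lambda>i. step z (f (\<sigma> i))) \<longlonglongrightarrow> smul \<theta> (z m)"
    by (rule LIM_zero_cancel)
  with \<sigma> \<open>norm \<theta> = 1\<close> show thesis by (rule that)
qed

lemma step_peak:
  assumes "measure M (E m) > 0"
  shows "step z (\<lambda>x. (1 / measure M (E m)) *\<^sub>R (indicat_real (E m) x *\<^sub>R 1)) = z m"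
proof -
  let ?f = "\<lambda>x. (1 / measure M (E m)) *\<^sub>R (indicat_real (E m) x *\<^sub>R (1::'k))"
  have "coeff n ?f = (if n = m then 1 else 0)" for n
  proof (cases "n = m")
    case True
    have "coeff n ?f = (1 / measure M (E m)) *\<^sub>R (\<integral>x. indicat_real (E m) x *\<^sub>R (1::'k) \<partial>M)"
      unfolding True integral_scaleR_right[symmetric]
      by (intro Bochner_Integration.integral_cong) (auto simp: indicator_def)
    also have "\<dots> = 1" using assms by (simp add: integral_indicator_scaleR sets_E)
    finally show ?thesis using True by simp
  next
    case False
    then have "E n \<inter> E m = {}" using disjoint_E by (simp add: disjoint_family_on_def)
    then have "(\<lambda>x. indicat_real (E n) x *\<^sub>R ?f x) = (\<lambda>x. 0)"
      by (auto simp: indicator_def fun_eq_iff)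
    then show ?thesis using False by simp
  qed
  then have "(\<lambda>n. smul (coeff n ?f) (z n)) = (\<lambda>n. if n = m then z n else 0)"
    by (simp add: fun_eq_iff)
  then show ?thesis
    unfolding step_operator_def by (simp add: sums_unique[OF sums_single, symmetric])
qed

end

context L1_operator
begin

text \<open>
  The space is exhausted by sets on which the averages oscillate by at most \<open>\<epsilon>\<close>. By countable
  additivity the difference of the two operators is at most \<open>\<epsilon> \<mu>(A)\<close> on the indicator of
  any \<open>A\<close>, since on \<open>E n \<inter> A\<close> it is \<open>\<mu>(E n \<inter> A)\<close> times a difference of two averages.
\<close>

lemma step_approximation:
  assumes D: "RNP_set D"
    and avg_D: "\<And>A. A \<in> sets M \<Longrightarrow> measure M A > 0 \<Longrightarrow> avg A \<in> D"
    and "\<epsilon> > 0"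
  obtains E where "disjoint_pieces M smul E"
    "\<And>f. integrable M f \<Longrightarrow>
      norm (U f - step_operator M smul E (\<lambda>n. avg (E n)) f) \<le> \<epsilon> * (\<integral>x. norm (f x) \<partial>M)"
proof -
  define P where "P E \<longleftrightarrow> (\<forall>A\<in>sets M. A \<subseteq> E \<longrightarrow> measure M A > 0 \<longrightarrow> norm (avg A - avg E) \<le> \<epsilon>)" for E
  have dense: "\<forall>B\<in>sets M. B \<subseteq> space M \<longrightarrow> measure M B > 0 \<longrightarrow>
      (\<exists>E\<in>sets M. E \<subseteq> B \<and> measure M E > 0 \<and> P E)"
  proof (intro ballI impI)
    fix B assume "B \<in> sets M" "measure M B > 0"
    from small_oscillation[OF D avg_D this \<open>\<epsilon> > 0\<close>]
    show "\<exists>E\<in>sets M. E \<subseteq> B \<and> measure M E > 0 \<and> P E" unfolding P_def by metis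
  qed
  obtain E :: "nat \<Rightarrow> 'a set" where E0: "\<forall>n. E n \<in> sets M \<and> E n \<subseteq> space M \<and>
      (E n = {} \<or> measure M (E n) > 0 \<and> P (E n))"
    and disj: "disjoint_family E" and co_null: "measure M (space M - (\<Union>n. E n)) = 0"
    using exhaustion[where P = P, OF sets.top dense] by (elim exE conjE)
  have E: "E n \<in> sets M" for n using E0 by blast
  interpret pieces: disjoint_pieces M smul E
    by unfold_locales (use E disj in auto)
  let ?S = "step_operator M smul E (\<lambda>n. avg (E n))"
  have avg_le: "norm (avg (E n)) \<le> C" for n by (rule norm_avg_le[OF E])
  interpret S: L1_operator M smul ?S C
    by (rule pieces.L1_operator_step[OF avg_le])
  have W: "L1_operator M smul (\<lambda>f. U f - ?S f) (C + C)"
  proof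
    fix f :: "'a \<Rightarrow> 'k" assume f: "integrable M f"
    show "norm (U f - ?S f) \<le> (C + C) * (\<integral>x. norm (f x) \<partial>M)"
      using norm_triangle_ineq4[of "U f" "?S f"] U_bound[OF f] S.U_bound[OF f]
      by (simp add: distrib_right)
  qed (simp_all add: U_add S.U_add U_mult S.U_mult scale_right_diff_distrib C_nonneg)
  have small: "norm (U (one_on A) - ?S (one_on A)) \<le> \<epsilon> * measure M A" if A: "A \<in> sets M" for A
  proof -
    have "measure M (A - (\<Union>n. E n)) \<le> measure M (space M - (\<Union>n. E n))"
      using E sets.sets_into_space[OF A] by (intro finite_measure_mono) auto
    then have null: "measure M (A - (\<Union>n. E n)) = 0"
      using co_null measure_nonneg[of M "A - (\<Union>n. E n)"] by linarith
    note cover = disjoint_cover_one_on[OF E disj A null]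
    have "pieces.coeff n (one_on A) = of_real (measure M (E n \<inter> A))" for n
    proof -
      have "pieces.coeff n (one_on A) = (\<integral>x. indicat_real (E n \<inter> A) x *\<^sub>R 1 \<partial>M)"
        by (simp add: indicator_inter_arith)
      also have "\<dots> = of_real (measure M (E n \<inter> A))"
        unfolding integral_indicator_scaleR[OF sets.Int[OF E A]] by (simp add: scaleR_conv_of_real)
      finally show ?thesis .
    qed
    then have "(\<lambda>n. measure M (E n \<inter> A) *\<^sub>R avg (E n)) sums ?S (one_on A)"
      using pieces.sums_step[OF avg_le integrable_one_on[OF A]] by (simp add: smul_of_real)
    from sums_diff[OF cover(1) this]
    have lim: "(\<lambda>N. norm (\<Sum>n<N. U (one_on (E n \<inter> A)) - measure M (E n \<inter> A) *\<^sub>R avg (E n)))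
        \<longlonglongrightarrow> norm (U (one_on A) - ?S (one_on A))"
      unfolding sums_def by (rule tendsto_norm)
    have lim': "(\<lambda>N. \<Sum>n<N. \<epsilon> * measure M (E n \<inter> A)) \<longlonglongrightarrow> \<epsilon> * measure M A"
      using sums_mult[OF cover(2)] unfolding sums_def .
    have piece: "norm (U (one_on (E n \<inter> A)) - measure M (E n \<inter> A) *\<^sub>R avg (E n)) \<le> \<epsilon> * measure M (E n \<inter> A)" for n
    proof -
      have "U (one_on (E n \<inter> A)) - measure M (E n \<inter> A) *\<^sub>R avg (E n)
          = measure M (E n \<inter> A) *\<^sub>R (avg (E n \<inter> A) - avg (E n))"
        using E[of n] A by (simp add: U_one_on scaleR_diff_right)
      moreover have "measure M (E n \<inter> A) > 0 \<Longrightarrow> norm (avg (E n \<inter> A) - avg (E n)) \<le> \<epsilon>"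
        using E0[rule_format, of n] E[of n] A unfolding P_def by auto
      ultimately show ?thesis
        using measure_nonneg[of M "E n \<inter> A"]
        by (cases "measure M (E n \<inter> A) = 0") (auto simp: mult.commute less_le)
    qed
    have "norm (\<Sum>n<N. U (one_on (E n \<inter> A)) - measure M (E n \<inter> A) *\<^sub>R avg (E n))
        \<le> (\<Sum>n<N. \<epsilon> * measure M (E n \<inter> A))" for N
      using piece by (rule sum_norm_le)
    then show ?thesis by (intro LIMSEQ_le[OF lim lim']) auto
  qed
  show thesis
  proof (rule that)
    show "disjoint_pieces M smul E" by (rule pieces.disjoint_pieces_axioms)
    show "norm (U f - ?S f) \<le> \<epsilon> * (\<integral>x. norm (f x) \<partial>M)" if "integrable M f" for f
      using L1_operator.U_norm_le_of_one_on[OF W small that] .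
  qed
qed

text \<open>
  The partial sums are values of \<open>U\<close> itself, at the functions that are constant on each of the
  first pieces with integral \<open>c n\<close> times that of \<open>f\<close>; replacing \<open>f\<close> by its means
  does not increase the norm.
\<close>

lemma step_avg_in_closure:
  assumes "disjoint_pieces M smul E"
    and c: "\<And>n. 0 \<le> c n" "\<And>n. c n \<le> 1"
    and f: "integrable M f"
  shows "step_operator M smul E (\<lambda>n. c n *\<^sub>R avg (E n)) f
    \<in> closure (U ` {g. integrable M g \<and> (\<integral>x. norm (g x) \<partial>M) \<le> (\<integral>x. norm (f x) \<partial>M)})"
proof -
  interpret pieces: disjoint_pieces M smul E by fact
  let ?a = "\<lambda>n. pieces.coeff n f"
  have bound: "norm (c n *\<^sub>R avg (E n)) \<le> C" for n
    using norm_avg_le[OF pieces.sets_E, of n] mult_left_le_one_le[of "norm (avg (E n))" "c n"] c[of n]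
    by simp
  have lim: "(\<lambda>N. \<Sum>n<N. smul (?a n) (c n *\<^sub>R avg (E n))) \<longlonglongrightarrow>
      step_operator M smul E (\<lambda>n. c n *\<^sub>R avg (E n)) f"
    using pieces.sums_step[OF bound f] unfolding sums_def .
  have partial: "(\<Sum>n<N. smul (?a n) (c n *\<^sub>R avg (E n)))
      \<in> U ` {g. integrable M g \<and> (\<integral>x. norm (g x) \<partial>M) \<le> (\<integral>x. norm (f x) \<partial>M)}" for N
  proof -
    define h where "h = (\<lambda>n x. (?a n * of_real (c n / measure M (E n))) * one_on (E n) x)"
    have h: "integrable M (h n)" for n
      unfolding h_def by (intro integrable_mult_right integrable_one_on pieces.sets_E)
    have norm_h: "(\<integral>x. norm (h n x) \<partial>M) \<le> norm (?a n)" for n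
    proof -
      have "(\<integral>x. norm (h n x) \<partial>M) = norm (?a n) * (c n / measure M (E n)) * (\<integral>x. norm (one_on (E n) x) \<partial>M)"
        unfolding h_def norm_mult integral_mult_right_zero norm_of_real using c by simp
      also have "(\<integral>x. norm (one_on (E n) x) \<partial>M) = measure M (E n)"
        by (rule integral_norm_one_on[OF pieces.sets_E])
      also have "norm (?a n) * (c n / measure M (E n)) * measure M (E n) \<le> norm (?a n)"
        using c[of n] by (cases "measure M (E n) = 0") (auto simp: mult_left_le)
      finally show ?thesis .
    qed
    have "(\<integral>x. norm (\<Sum>n<N. h n x) \<partial>M) \<le> (\<integral>x. (\<Sum>n<N. norm (h n x)) \<partial>M)"
      using h by (intro integral_mono) (auto intro: norm_sum)
    also have "\<dots> = (\<Sum>n<N. \<integral>x. norm (h n x) \<partial>M)"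
      using h by (intro Bochner_Integration.integral_sum) auto
    also have "\<dots> \<le> (\<Sum>n<N. norm (?a n))"
      using norm_h by (rule sum_mono)
    also have "\<dots> \<le> (\<integral>x. norm (f x) \<partial>M)"
      by (rule pieces.sum_norm_coeff_le[OF f]) simp
    finally have "(\<integral>x. norm (\<Sum>n<N. h n x) \<partial>M) \<le> (\<integral>x. norm (f x) \<partial>M)" .
    moreover have "(\<Sum>n<N. smul (?a n) (c n *\<^sub>R avg (E n))) = (\<Sum>n<N. U (h n))"
      unfolding avg_scaleR_eq[OF pieces.sets_E] h_def ..
    moreover have "(\<Sum>n<N. U (h n)) = U (\<lambda>x. \<Sum>n<N. h n x)"
      by (rule U_sum[OF h, symmetric])
    moreover have "integrable M (\<lambda>x. \<Sum>n<N. h n x)"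
      using h by (rule Bochner_Integration.integrable_sum)
    ultimately show ?thesis by (intro image_eqI[where x = "\<lambda>x. \<Sum>n<N. h n x"]) auto
  qed
  show ?thesis
    unfolding closure_sequential by (intro exI conjI allI) (rule partial, rule lim)
qed

end

section \<open>Passing to the classes of integrable functions\<close>

lemma rep_L1:
  assumes "F \<in> vecs (L1 M)"
  shows "integrable M (rep F)" "ae_class M (rep F) = F"
proof -
  obtain f where f: "integrable M f" "F = ae_class M f"
    using assms by (auto simp: vecs_L1)
  show "integrable M (rep F)" unfolding f(2) using f(1) by (rule rep_ae_class(1))
  show "ae_class M (rep F) = F"
    using rep_ae_class[OF f(1)] f by (simp add: ae_class_eq_iff)
qed

lemma unit_ball_L1: "unit_ball (L1 M) = ae_class M ` {f. integrable M f \<and> (\<integral>x. norm (f x) \<partial>M) \<le> 1}"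
  by (auto simp: unit_ball_def vecs_L1 norm_L1)

lemma rep_unit_ball_L1:
  assumes "F \<in> unit_ball (L1 M)"
  shows "integrable M (rep F)" "(\<integral>x. norm (rep F x) \<partial>M) \<le> 1" "ae_class M (rep F) = F"
  using assms rep_L1[of F M] by (auto simp: unit_ball_def L1_def)

lemma op_norm_L1_le:
  assumes "\<And>F. F \<in> unit_ball (L1 M) \<Longrightarrow> norm (T F) \<le> K"
  shows "op_norm (L1 M) T \<le> K"
proof -
  have "ae_class M (\<lambda>x. 0) \<in> unit_ball (L1 M)" by (simp add: unit_ball_L1)
  then show ?thesis unfolding op_norm_def by (intro cSUP_least assms) blast+
qed

lemma L1_operator_of_bounded_operator:
  fixes smul :: "'k::real_or_complex \<Rightarrow> 'b::banach \<Rightarrow> 'b"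
  assumes "finite_measure M" "banach_over smul" and T: "bounded_operator (L1 M) smul T"
  obtains C where "L1_operator M smul (\<lambda>f. T (ae_class M f)) C"
proof -
  interpret finite_measure M by fact
  interpret banach_over smul by fact
  obtain C where C: "\<And>F. F \<in> vecs (L1 M) \<Longrightarrow> norm (T F) \<le> C * norm_v (L1 M) F"
    using T unfolding bounded_operator_def by blast
  have in_vecs: "ae_class M f \<in> vecs (L1 M)" if "integrable M f" for f
    using that by (auto simp: vecs_L1)
  have "L1_operator M smul (\<lambda>f. T (ae_class M f)) \<bar>C\<bar>"
  proof
    fix f g :: "'a \<Rightarrow> 'k" assume f: "integrable M f" and g: "integrable M g"
    show "T (ae_class M (\<lambda>x. f x + g x)) = T (ae_class M f) + T (ae_class M g)"
      using T in_vecs[OF f] in_vecs[OF g] plus_L1[OF f g] unfolding bounded_operator_def by metis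
  next
    fix f :: "'a \<Rightarrow> 'k" and c assume f: "integrable M f"
    show "T (ae_class M (\<lambda>x. c * f x)) = smul c (T (ae_class M f))"
      using T in_vecs[OF f] scale_L1[OF f] unfolding bounded_operator_def by metis
  next
    fix f :: "'a \<Rightarrow> 'k" assume f: "integrable M f"
    have "norm (T (ae_class M f)) \<le> C * (\<integral>x. norm (f x) \<partial>M)"
      using C[OF in_vecs[OF f]] f by (simp add: norm_L1)
    also have "\<dots> \<le> \<bar>C\<bar> * (\<integral>x. norm (f x) \<partial>M)"
      by (intro mult_right_mono) auto
    finally show "norm (T (ae_class M f)) \<le> \<bar>C\<bar> * (\<integral>x. norm (f x) \<partial>M)" .
  qed simp
  then show thesis by (rule that)
qed

lemma (in L1_operator) U_rep_ae_class:
  "integrable M f \<Longrightarrow> U (rep (ae_class M f)) = U f"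
  by (intro U_cong_AE rep_ae_class)

lemma (in L1_operator) bounded_operator_rep: "bounded_operator (L1 M) smul (\<lambda>F. U (rep F))"
  unfolding bounded_operator_def
proof (intro conjI allI ballI exI[of _ C])
  fix F G :: "('a \<Rightarrow> 'k) set" assume "F \<in> vecs (L1 M)" "G \<in> vecs (L1 M)"
  then obtain f g where "integrable M f" "F = ae_class M f" "integrable M g" "G = ae_class M g"
    by (auto simp: vecs_L1)
  then show "U (rep (plus_v (L1 M) F G)) = U (rep F) + U (rep G)"
    by (simp add: plus_L1 U_rep_ae_class U_add)
next
  fix c and F :: "('a \<Rightarrow> 'k) set" assume "F \<in> vecs (L1 M)"
  then obtain f where "integrable M f" "F = ae_class M f"
    by (auto simp: vecs_L1)
  then show "U (rep (scale_v (L1 M) c F)) = smul c (U (rep F))"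
    by (simp add: scale_L1 U_rep_ae_class U_mult)
next
  fix F :: "('a \<Rightarrow> 'k) set" assume "F \<in> vecs (L1 M)"
  then obtain f where "integrable M f" "F = ae_class M f"
    by (auto simp: vecs_L1)
  then show "norm (U (rep F)) \<le> C * norm_v (L1 M) F"
    by (simp add: norm_L1 U_rep_ae_class U_bound)
qed

text \<open>
  A strictly longest value makes the operator range strongly exposing, and the norm is attained
  at the normalised indicator of the piece that carries this value.
\<close>

lemma (in disjoint_pieces) step_RSE:
  assumes z: "\<And>n. n \<noteq> m \<Longrightarrow> norm (z n) \<le> s" and s: "0 \<le> s" "s < norm (z m)"
    and pos: "measure M (E m) > 0"
  shows "(\<lambda>F. step z (rep F)) \<in> RSE (L1 M) smul"
proof -
  have z_le: "norm (z n) \<le> norm (z m)" for n using z[of n] s by (cases "n = m") auto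
  interpret S: L1_operator M smul "step z" "norm (z m)"
    by (rule L1_operator_step[OF z_le])
  define e where "e = (\<lambda>x. (1 / measure M (E m)) *\<^sub>R (indicat_real (E m) x *\<^sub>R (1::'k)))"
  have e: "integrable M e"
    unfolding e_def by (intro integrable_scaleR_right S.integrable_one_on sets_E)
  have norm_e: "(\<integral>x. norm (e x) \<partial>M) = 1"
    using pos sets_E by (simp add: e_def)
  have peak: "step z (rep (ae_class M e)) = z m"
    unfolding S.U_rep_ae_class[OF e] unfolding e_def by (rule step_peak[OF pos])
  have e_ball: "ae_class M e \<in> unit_ball (L1 M)" using e norm_e by (auto simp: unit_ball_L1)
  have le: "norm (step z (rep F)) \<le> norm (z m)" if "F \<in> unit_ball (L1 M)" for F
  proof -
    note F = rep_unit_ball_L1[OF that]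
    show ?thesis
      using S.U_bound[OF F(1)] mult_left_le[OF F(2) norm_ge_zero[of "z m"]] by linarith
  qed
  have op_norm: "op_norm (L1 M) (\<lambda>F. step z (rep F)) = norm (z m)"
  proof (rule antisym)
    show "op_norm (L1 M) (\<lambda>F. step z (rep F)) \<le> norm (z m)" by (rule op_norm_L1_le[OF le])
    have "norm (step z (rep (ae_class M e))) \<le> op_norm (L1 M) (\<lambda>F. step z (rep F))"
      unfolding op_norm_def using le by (intro cSUP_upper[OF e_ball] bdd_aboveI2) auto
    then show "norm (z m) \<le> op_norm (L1 M) (\<lambda>F. step z (rep F))" by (simp add: peak)
  qed
  show ?thesis
    unfolding RSE_def
  proof (intro CollectI conjI bexI[of _ "ae_class M e"] allI impI)
    show "bounded_operator (L1 M) smul (\<lambda>F. step z (rep F))" by (rule S.bounded_operator_rep)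
    show "ae_class M e \<in> unit_sphere (L1 M)"
      using e norm_e by (auto simp: unit_sphere_def vecs_L1 norm_L1)
  next
    fix F :: "nat \<Rightarrow> ('a \<Rightarrow> 'k) set"
    assume "(\<forall>n. F n \<in> unit_ball (L1 M)) \<and>
      (\<lambda>n. norm (step z (rep (F n)))) \<longlonglongrightarrow> op_norm (L1 M) (\<lambda>F. step z (rep F))"
    then have ball: "F n \<in> unit_ball (L1 M)" and lim: "(\<lambda>n. norm (step z (rep (F n)))) \<longlonglongrightarrow> norm (z m)" for n
      unfolding op_norm by auto
    obtain \<sigma> :: "nat \<Rightarrow> nat" and \<theta> :: 'k where "strict_mono \<sigma>" "norm \<theta> = 1"
        "(\<lambda>n. step z (rep (F (\<sigma> n)))) \<longlonglongrightarrow> smul \<theta> (z m)"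
      using step_almost_norming[OF z s rep_unit_ball_L1(1,2)[OF ball] lim] .
    then show "\<exists>\<sigma> \<theta>. strict_mono \<sigma> \<and> norm \<theta> = 1 \<and>
        (\<lambda>n. step z (rep (F (\<sigma> n)))) \<longlonglongrightarrow> smul \<theta> (step z (rep (ae_class M e)))"
      unfolding peak by blast
  qed
qed

text \<open>
  This covers the case in which all averages vanish, where no value can be enlarged. Only the
  existence of a unit vector is at stake.
\<close>

lemma zero_RSE_L1:
  fixes smul :: "'k::real_or_complex \<Rightarrow> 'b::banach \<Rightarrow> 'b"
  assumes "banach_over smul"
    and "\<exists>F \<in> vecs (L1 M :: ('k, ('a \<Rightarrow> 'k) set) nspace). norm_v (L1 M) F \<noteq> 0"
  shows "(\<lambda>F. 0) \<in> RSE (L1 M) smul"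
proof -
  interpret banach_over smul by fact
  obtain f :: "'a \<Rightarrow> 'k" where f: "integrable M f" "(\<integral>x. norm (f x) \<partial>M) \<noteq> 0"
    using assms(2) by (auto simp: vecs_L1 norm_L1)
  define r where "r = (\<integral>x. norm (f x) \<partial>M)"
  have "r > 0" using f(2) by (simp add: r_def less_le)
  have "ae_class M (\<lambda>x. (1 / r) *\<^sub>R f x) \<in> unit_sphere (L1 M)"
    using f(1) \<open>r > 0\<close> by (auto simp: unit_sphere_def vecs_L1 norm_L1 r_def[symmetric])
  moreover have "bounded_operator (L1 M) smul (\<lambda>F. 0)"
    by (auto simp: bounded_operator_def intro: exI[of _ 0])
  moreover have "strict_mono (id :: nat \<Rightarrow> nat) \<and> norm (1::'k) = 1 \<and> (\<lambda>n::nat. 0) \<longlonglongrightarrow> smul 1 0"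
    by (simp add: strict_mono_def)
  ultimately show ?thesis
    unfolding RSE_def by blast
qed

section \<open>Density of range strongly exposing operators\<close>

theorem theorem3p5:
  fixes M :: "'a measure"
    and smul :: "'k::real_or_complex \<Rightarrow> 'b::banach \<Rightarrow> 'b"
    and T :: "('a \<Rightarrow> 'k) set \<Rightarrow> 'b"
    and \<epsilon> :: real
  assumes "finite_measure M"
    and "\<exists>F \<in> vecs (L1 M :: ('k, ('a \<Rightarrow> 'k) set) nspace). norm_v (L1 M) F \<noteq> 0"
    and "banach_over smul"
    and "\<exists>y::'b. y \<noteq> 0"
    and "strong_RN_operator (L1 M) smul T"
    and "\<epsilon> > 0"
  shows "\<exists>S \<in> RSE (L1 M) smul.
           op_norm (L1 M) (\<lambda>F. T F - S F) \<le> \<epsilon> \<and>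
           (\<exists>\<beta>>0. closure (S ` unit_ball (L1 M)) \<subseteq> (\<lambda>y. \<beta> *\<^sub>R y) ` closure (T ` unit_ball (L1 M)))"
proof -
  obtain C where "L1_operator M smul (\<lambda>f. T (ae_class M f)) C"
    using L1_operator_of_bounded_operator[OF assms(1,3)] assms(5)
    unfolding strong_RN_operator_def by blast
  then interpret T: L1_operator M smul "\<lambda>f. T (ae_class M f)" C .
  define D where "D = closure (T ` unit_ball (L1 M))"
  have D_eq: "D = closure ((\<lambda>f. T (ae_class M f)) ` {f. integrable M f \<and> (\<integral>x. norm (f x) \<partial>M) \<le> 1})"
    unfolding D_def unit_ball_L1 by (simp add: image_image)
  have RNP: "RNP_set D" using assms(5) by (simp add: strong_RN_operator_def D_def)
  have avg_D: "T.avg A \<in> D" if "A \<in> sets M" "measure M A > 0" for A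
  proof -
    let ?g = "\<lambda>x. (1 / measure M A) *\<^sub>R (indicat_real A x *\<^sub>R (1::'k))"
    have "integrable M ?g"
      by (intro integrable_scaleR_right T.integrable_one_on that)
    moreover have "(\<integral>x. norm (?g x) \<partial>M) \<le> 1"
      using that by simp
    moreover have "T.avg A = T (ae_class M ?g)"
      unfolding T.avg_def by (rule T.U_scaleR[symmetric, OF T.integrable_one_on[OF that(1)]])
    ultimately show ?thesis
      unfolding D_eq by (intro subsetD[OF closure_subset]) blast
  qed
  obtain E where "disjoint_pieces M smul E" and approx: "\<And>f. integrable M f \<Longrightarrow>
      norm (T (ae_class M f) - step_operator M smul E (\<lambda>n. T.avg (E n)) f) \<le> \<epsilon> / 2 * (\<integral>x. norm (f x) \<partial>M)"
    using T.step_approximation[OF RNP avg_D, of "\<epsilon> / 2"] \<open>\<epsilon> > 0\<close> by (auto simp del: times_divide_eq_left)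
  then interpret E: disjoint_pieces M smul E by simp
  define y where "y = (\<lambda>n. T.avg (E n))"
  have y_le: "norm (y n) \<le> C" for n unfolding y_def by (rule T.norm_avg_le[OF E.sets_E])
  have approx_ball: "norm (T F - E.step y (rep F)) \<le> \<epsilon> / 2" if "F \<in> unit_ball (L1 M)" for F
  proof -
    note F = rep_unit_ball_L1[OF that]
    have "norm (T F - E.step y (rep F)) \<le> \<epsilon> / 2 * (\<integral>x. norm (rep F x) \<partial>M)"
      using approx[OF F(1)] unfolding F(3) y_def .
    also have "\<dots> \<le> \<epsilon> / 2"
      using F(2) \<open>\<epsilon> > 0\<close> by (intro mult_left_le) auto
    finally show ?thesis .
  qed
  have zero_D: "0 \<in> D"
  proof -
    have "T (ae_class M (\<lambda>x. 0)) \<in> T ` unit_ball (L1 M)"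
      unfolding unit_ball_L1 by (intro imageI) simp
    then show ?thesis
      unfolding D_def T.U_zero by (rule subsetD[OF closure_subset])
  qed
  show ?thesis
  proof (cases "\<forall>n. y n = 0")
    case True
    have step_0: "E.step y f = 0" for f by (simp add: step_operator_def True)
    show ?thesis
    proof (intro bexI[of _ "\<lambda>F. 0"] conjI exI[of _ 1])
      show "op_norm (L1 M) (\<lambda>F. T F - 0) \<le> \<epsilon>"
      proof (rule op_norm_L1_le)
        fix F :: "('a \<Rightarrow> 'k) set" assume "F \<in> unit_ball (L1 M)"
        then show "norm (T F - 0) \<le> \<epsilon>"
          using approx_ball[of F] \<open>\<epsilon> > 0\<close> by (simp add: step_0)
      qed
      have "closure ((\<lambda>F::('a \<Rightarrow> 'k) set. 0::'b) ` unit_ball (L1 M)) \<subseteq> closure {0}"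
        by (rule closure_mono) auto
      then show "closure ((\<lambda>F::('a \<Rightarrow> 'k) set. 0) ` unit_ball (L1 M)) \<subseteq> (\<lambda>y. 1 *\<^sub>R y) ` closure (T ` unit_ball (L1 M))"
        using zero_D by (simp flip: D_def) blast
    qed (use zero_RSE_L1[OF assms(3,2)] in simp_all)
  next
    case False
    then obtain k where "y k \<noteq> 0" by blast
    define s where "s = (SUP n. norm (y n))"
    have bdd: "bdd_above (range (\<lambda>n. norm (y n)))" using y_le by (intro bdd_aboveI2)
    have y_s: "norm (y n) \<le> s" for n unfolding s_def using bdd by (intro cSUP_upper) auto
    have "s > 0" using y_s[of k] \<open>y k \<noteq> 0\<close> by (meson less_le_trans zero_less_norm_iff)
    \<comment> \<open>the largest proportion by which any value can be lengthened without moving it by more than \<open>\<epsilon> / 2\<close>\<close>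
    define t where "t = \<epsilon> / (2 * s)"
    have "t > 0" using \<open>\<epsilon> > 0\<close> \<open>s > 0\<close> by (simp add: t_def)
    have "s / (1 + t) < s" using \<open>s > 0\<close> \<open>t > 0\<close> by (simp add: divide_less_eq)
    then obtain m where m: "s / (1 + t) < norm (y m)"
      unfolding s_def using less_cSUP_iff[OF _ bdd] by auto
    \<comment> \<open>\<open>z\<close> is \<open>y\<close> with \<open>y m\<close> enlarged by the factor \<open>1 + t\<close>, written as \<open>1 + t\<close> times values
      \<open>c n *\<^sub>R y n\<close> no longer than the averages, so that the image of the ball can be located\<close>
    define c where "c n = (if n = m then 1 else 1 / (1 + t))" for n
    have c: "0 \<le> c n" "c n \<le> 1" for n using \<open>t > 0\<close> by (auto simp: c_def)
    define z where "z n = (1 + t) *\<^sub>R (c n *\<^sub>R y n)" for n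
    have z_m: "z m = (1 + t) *\<^sub>R y m" and z_n: "n \<noteq> m \<Longrightarrow> z n = y n" for n
      using \<open>t > 0\<close> by (auto simp: z_def c_def)
    have "s < norm (z m)"
      using m \<open>t > 0\<close> by (simp add: z_m pos_divide_less_eq mult.commute)
    have cy_le: "norm (c n *\<^sub>R y n) \<le> s" for n
      using y_s[of n] mult_left_le_one_le[of "norm (y n)" "c n"] c[of n] by simp
    have z_le: "norm (z n) \<le> (1 + t) * s" for n
      unfolding z_def using cy_le[of n] \<open>t > 0\<close> by (simp del: scaleR_scaleR)
    have "norm (y m) > 0" using m \<open>s > 0\<close> \<open>t > 0\<close> by (meson add_pos_pos divide_pos_pos less_trans zero_less_one)
    then have "measure M (E m) \<noteq> 0" by (auto simp: y_def T.avg_def)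
    then have "measure M (E m) > 0" using measure_nonneg[of M "E m"] by linarith
    have RSE: "(\<lambda>F. E.step z (rep F)) \<in> RSE (L1 M) smul"
    proof (rule E.step_RSE)
      show "norm (z n) \<le> s" if "n \<noteq> m" for n using that y_s by (simp add: z_n)
    qed (use \<open>s > 0\<close> \<open>s < norm (z m)\<close> \<open>measure M (E m) > 0\<close> in auto)
    have zy: "norm (z n - y n) \<le> \<epsilon> / 2" for n
    proof (cases "n = m")
      case True
      have "norm (z n - y n) = t * norm (y m)"
        using \<open>t > 0\<close> by (simp add: True z_m scaleR_add_left)
      also have "\<dots> \<le> t * s" using y_s[of m] \<open>t > 0\<close> by (intro mult_left_mono) auto
      also have "\<dots> = \<epsilon> / 2" using \<open>s > 0\<close> by (simp add: t_def)
      finally show ?thesis .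
    qed (use \<open>\<epsilon> > 0\<close> in \<open>simp add: z_n\<close>)
    have op_norm: "op_norm (L1 M) (\<lambda>F. T F - E.step z (rep F)) \<le> \<epsilon>"
    proof (rule op_norm_L1_le)
      fix F :: "('a \<Rightarrow> 'k) set" assume F_ball: "F \<in> unit_ball (L1 M)"
      note F = rep_unit_ball_L1[OF F_ball]
      have "norm (E.step z (rep F) - E.step y (rep F)) \<le> \<epsilon> / 2 * (\<integral>x. norm (rep F x) \<partial>M)"
        using E.norm_step_le[OF zy F(1)] by (simp add: E.step_diff[OF z_le y_le F(1)])
      also have "\<dots> \<le> \<epsilon> / 2"
        using F(2) \<open>\<epsilon> > 0\<close> by (intro mult_left_le) auto
      finally show "norm (T F - E.step z (rep F)) \<le> \<epsilon>"
        using approx_ball[OF F_ball]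
          norm_triangle_ineq4[of "T F - E.step y (rep F)" "E.step z (rep F) - E.step y (rep F)"]
        by simp
    qed
    have "E.step z (rep F) \<in> (\<lambda>y. (1 + t) *\<^sub>R y) ` D" if "F \<in> unit_ball (L1 M)" for F
    proof -
      note F = rep_unit_ball_L1[OF that]
      have "E.step (\<lambda>n. c n *\<^sub>R y n) (rep F) \<in> closure ((\<lambda>f. T (ae_class M f)) `
          {g. integrable M g \<and> (\<integral>x. norm (g x) \<partial>M) \<le> (\<integral>x. norm (rep F x) \<partial>M)})"
        unfolding y_def by (rule T.step_avg_in_closure[OF E.disjoint_pieces_axioms c F(1)])
      also have "\<dots> \<subseteq> D"
        unfolding D_eq using F(2) by (intro closure_mono image_mono) auto
      finally have "E.step (\<lambda>n. c n *\<^sub>R y n) (rep F) \<in> D" .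
      moreover have "E.step z (rep F) = (1 + t) *\<^sub>R E.step (\<lambda>n. c n *\<^sub>R y n) (rep F)"
        unfolding z_def by (rule E.step_scaleR[OF cy_le F(1)])
      ultimately show ?thesis by blast
    qed
    moreover have "closed ((\<lambda>y. (1 + t) *\<^sub>R y) ` D)"
      by (rule closed_scaling) (simp add: D_def)
    ultimately have "closure ((\<lambda>F. E.step z (rep F)) ` unit_ball (L1 M)) \<subseteq> (\<lambda>y. (1 + t) *\<^sub>R y) ` D"
      by (intro closure_minimal) auto
    then show ?thesis
      using RSE op_norm \<open>t > 0\<close> unfolding D_def
      by (intro bexI[of _ "\<lambda>F. E.step z (rep F)"] conjI exI[of _ "1 + t"]) auto
  qed
qed

end
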